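(* If $(T,X)$ is an invertible semiflow on a nonempty compact Hausdorff space $X$ with $T$ an almost right C-semigroup, then $Q(T,X)$ is invariant, i.e. $(x,y)\in Q(T,X)$ and $t\in T$ imply $(tx,ty)\in Q(T,X)$.
   Context: $T$ is a topological semigroup with identity $e$. A semiflow $(T,X)$ is a jointly continuous map $T\times X\to X$, $(t,x)\mapsto tx$, with $ex=x$ and $t(sx)=(ts)x$. It is invertible if each transition $x\mapsto tx$, $t\in T$, is a bijection of $X$. $T$ is an almost right C-semigroup if $\{t\in T : \overline{T\setminus Tt}\text{ is compact in }T\}$ is dense in $T$. $(x,x')\in Q(T,X)$ (regionally proximal) if there are nets $\{x_n\},\{x_n'\}$ in $X$ and $\{t_n\}$ in $T$ with $x_n\to x$, $x_n'\to x'$ and $\lim_n t_nx_n=\lim_n t_nx_n'$. *)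

theory Defs
  imports "HOL-Analysis.Analysis"
begin

text \<open>
  The acting semigroup is a type of class \<open>topological_monoid_mult\<close> (jointly continuous,
  associative, not necessarily commutative multiplication, with identity \<open>1\<close>; no separation
  axiom). The phase space is a topological type, hence automatically nonempty.
\<close>

definition semiflow ::
  "('t::topological_monoid_mult \<Rightarrow> 'x::topological_space \<Rightarrow> 'x) \<Rightarrow> bool" where
  "semiflow \<phi> \<longleftrightarrow>
     continuous_on UNIV (\<lambda>(t, x). \<phi> t x) \<and>
     (\<forall>x. \<phi> 1 x = x) \<and>
     (\<forall>t s x. \<phi> t (\<phi> s x) = \<phi> (t * s) x)"

definition invertible_semiflow ::
  "('t::topological_monoid_mult \<Rightarrow> 'x::topological_space \<Rightarrow> 'x) \<Rightarrow> bool" where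
  "invertible_semiflow \<phi> \<longleftrightarrow> semiflow \<phi> \<and> (\<forall>t. bij (\<phi> t))"

definition almost_right_C_semigroup :: "'t::topological_monoid_mult itself \<Rightarrow> bool" where
  "almost_right_C_semigroup _ \<longleftrightarrow>
     closure {t::'t. compact (closure (UNIV - range (\<lambda>s. s * t)))} = UNIV"


text \<open>
  A net is a function on a directed set \<open>(D, le)\<close>; its convergence is convergence along the
  filter generated by the tails of \<open>D\<close>.
\<close>

definition directed_set :: "'i set \<Rightarrow> ('i \<Rightarrow> 'i \<Rightarrow> bool) \<Rightarrow> bool" where
  "directed_set D le \<longleftrightarrow>
     D \<noteq> {} \<and>
     (\<forall>i\<in>D. le i i) \<and>
     (\<forall>i\<in>D. \<forall>j\<in>D. \<forall>k\<in>D. le i j \<longrightarrow> le j k \<longrightarrow> le i k) \<and>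
     (\<forall>i\<in>D. \<forall>j\<in>D. \<exists>k\<in>D. le i k \<and> le j k)"

definition tails :: "'i set \<Rightarrow> ('i \<Rightarrow> 'i \<Rightarrow> bool) \<Rightarrow> 'i filter" where
  "tails D le = (INF i\<in>D. principal {j\<in>D. le i j})"

lemma eventually_tails:
  assumes "directed_set D le"
  shows "eventually P (tails D le) \<longleftrightarrow> (\<exists>i\<in>D. \<forall>j\<in>D. le i j \<longrightarrow> P j)"
proof -
  have "eventually P (tails D le) \<longleftrightarrow> (\<exists>i\<in>D. eventually P (principal {j\<in>D. le i j}))"
    unfolding tails_def
  proof (rule eventually_INF_base)
    show "D \<noteq> {}" using assms by (simp add: directed_set_def)
    fix a b assume ab: "a \<in> D" "b \<in> D"
    then obtain k where k: "k \<in> D" "le a k" "le b k"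
      using assms unfolding directed_set_def by meson
    have tr: "le i l" if "i \<in> D" "j \<in> D" "l \<in> D" "le i j" "le j l" for i j l
      using assms that unfolding directed_set_def by meson
    have "{j\<in>D. le k j} \<subseteq> {j\<in>D. le a j} \<inter> {j\<in>D. le b j}"
      using tr[OF ab(1) k(1) _ k(2)] tr[OF ab(2) k(1) _ k(3)] by blast
    then show "\<exists>x\<in>D. principal {j\<in>D. le x j} \<le>
        inf (principal {j\<in>D. le a j}) (principal {j\<in>D. le b j})"
      using k(1) by (auto simp: inf_principal intro!: bexI[of _ k])
  qed
  then show ?thesis by (auto simp: eventually_principal)
qed

text \<open>
  Nets \<open>x\<^sub>n\<close>, \<open>x'\<^sub>n\<close>, \<open>t\<^sub>n\<close> on the directed set \<open>(D, le)\<close> that witness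
  \<open>(x, x') \<in> Q(T, X)\<close>.
\<close>

definition regionally_proximal_nets ::
  "('t::topological_monoid_mult \<Rightarrow> 'x::topological_space \<Rightarrow> 'x) \<Rightarrow> 'x \<Rightarrow> 'x \<Rightarrow>
   'i set \<Rightarrow> ('i \<Rightarrow> 'i \<Rightarrow> bool) \<Rightarrow> ('i \<Rightarrow> 'x) \<Rightarrow> ('i \<Rightarrow> 'x) \<Rightarrow> ('i \<Rightarrow> 't) \<Rightarrow> bool" where
  "regionally_proximal_nets \<phi> x x' D le xn xn' tn \<longleftrightarrow>
     directed_set D le \<and>
     (xn \<longlongrightarrow> x) (tails D le) \<and>
     (xn' \<longlongrightarrow> x') (tails D le) \<and>
     (\<exists>z. ((\<lambda>n. \<phi> (tn n) (xn n)) \<longlongrightarrow> z) (tails D le) \<and>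
          ((\<lambda>n. \<phi> (tn n) (xn' n)) \<longlongrightarrow> z) (tails D le))"

text \<open>
  A definition cannot quantify over the index type of the nets. It is therefore fixed to be
  \<open>'x set \<times> 'x set \<times> 'x set\<close>, which is large enough: the lemma \<open>Q_rel_if_nets\<close> below shows
  that nets over an arbitrary index type define the same relation.
\<close>

definition Q_rel ::
  "('t::topological_monoid_mult \<Rightarrow> 'x::topological_space \<Rightarrow> 'x) \<Rightarrow> ('x \<times> 'x) set" where
  "Q_rel \<phi> = {(x, x').
     \<exists>(D :: ('x set \<times> 'x set \<times> 'x set) set) le xn xn' tn.
       regionally_proximal_nets \<phi> x x' D le xn xn' tn}"

lemma Q_rel_if_nets:
  fixes \<phi> :: "'t::topological_monoid_mult \<Rightarrow> 'x::topological_space \<Rightarrow> 'x"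
    and D :: "'i set"
  assumes "regionally_proximal_nets \<phi> x x' D le xn xn' tn"
  shows "(x, x') \<in> Q_rel \<phi>"
proof -
  let ?F = "tails D le"
  from assms obtain z where dir: "directed_set D le"
    and lim: "(xn \<longlongrightarrow> x) ?F" "(xn' \<longlongrightarrow> x') ?F"
      "((\<lambda>n. \<phi> (tn n) (xn n)) \<longlongrightarrow> z) ?F" "((\<lambda>n. \<phi> (tn n) (xn' n)) \<longlongrightarrow> z) ?F"
    by (auto simp: regionally_proximal_nets_def)
  define E where "E = {(U, V, W). open U \<and> x \<in> U \<and> open V \<and> x' \<in> V \<and> open W \<and> z \<in> W}"
  define ge where "ge = (\<lambda>(U, V, W) (U', V', W').
      (U'::'x set) \<subseteq> U \<and> (V'::'x set) \<subseteq> V \<and> (W'::'x set) \<subseteq> W)"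
  define good where "good = (\<lambda>(U, V, W) n.
      xn n \<in> U \<and> xn' n \<in> V \<and> \<phi> (tn n) (xn n) \<in> W \<and> \<phi> (tn n) (xn' n) \<in> W)"
  have "\<exists>n. good e n" if "e \<in> E" for e
  proof -
    obtain U V W where e: "e = (U, V, W)" by (cases e)
    with that have "\<forall>\<^sub>F n in ?F. xn n \<in> U" "\<forall>\<^sub>F n in ?F. xn' n \<in> V"
      "\<forall>\<^sub>F n in ?F. \<phi> (tn n) (xn n) \<in> W" "\<forall>\<^sub>F n in ?F. \<phi> (tn n) (xn' n) \<in> W"
      using lim by (auto simp: E_def intro: topological_tendstoD)
    then have "\<forall>\<^sub>F n in ?F. good e n"
      by eventually_elim (simp add: e good_def)
    then obtain i where "i \<in> D" "\<forall>j\<in>D. le i j \<longrightarrow> good e j"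
      using eventually_tails[OF dir] by blast
    moreover have "le i i" using dir \<open>i \<in> D\<close> unfolding directed_set_def by blast
    ultimately show ?thesis by blast
  qed
  then obtain p where p: "good e (p e)" if "e \<in> E" for e by metis
  have top: "(UNIV, UNIV, UNIV) \<in> E" by (simp add: E_def)
  have dirE: "directed_set E ge"
    unfolding directed_set_def
  proof (intro conjI ballI)
    show "E \<noteq> {}" using top by blast
    fix e f assume ef: "e \<in> E" "f \<in> E"
    obtain U V W U' V' W' where "e = (U, V, W)" "f = (U', V', W')" by (cases e, cases f)
    then show "\<exists>k\<in>E. ge e k \<and> ge f k"
      using ef by (intro bexI[of _ "(U \<inter> U', V \<inter> V', W \<inter> W')"]) (auto simp: E_def ge_def)
  qed (auto simp: ge_def)
  have conv: "(f \<longlongrightarrow> l) (tails E ge)"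
    if "\<And>S. open S \<Longrightarrow> l \<in> S \<Longrightarrow> \<exists>i\<in>E. \<forall>j\<in>E. ge i j \<longrightarrow> f j \<in> S" for f :: "_ \<Rightarrow> 'x" and l
    using that by (intro topological_tendstoI) (simp add: eventually_tails[OF dirE])
  have "regionally_proximal_nets \<phi> x x' E ge (xn \<circ> p) (xn' \<circ> p) (tn \<circ> p)"
    unfolding regionally_proximal_nets_def
  proof (intro conjI exI[of _ z])
    show "directed_set E ge" by (fact dirE)
    show "((xn \<circ> p) \<longlongrightarrow> x) (tails E ge)"
    proof (rule conv)
      fix S assume "open S" "x \<in> S"
      then show "\<exists>i\<in>E. \<forall>j\<in>E. ge i j \<longrightarrow> (xn \<circ> p) j \<in> S"
        by (intro bexI[of _ "(S, UNIV, UNIV)"]) (force simp: ge_def good_def E_def dest!: p)+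
    qed
    show "((xn' \<circ> p) \<longlongrightarrow> x') (tails E ge)"
    proof (rule conv)
      fix S assume "open S" "x' \<in> S"
      then show "\<exists>i\<in>E. \<forall>j\<in>E. ge i j \<longrightarrow> (xn' \<circ> p) j \<in> S"
        by (intro bexI[of _ "(UNIV, S, UNIV)"]) (force simp: ge_def good_def E_def dest!: p)+
    qed
    show "((\<lambda>n. \<phi> ((tn \<circ> p) n) ((xn \<circ> p) n)) \<longlongrightarrow> z) (tails E ge)"
    proof (rule conv)
      fix S assume "open S" "z \<in> S"
      then show "\<exists>i\<in>E. \<forall>j\<in>E. ge i j \<longrightarrow> \<phi> ((tn \<circ> p) j) ((xn \<circ> p) j) \<in> S"
        by (intro bexI[of _ "(UNIV, UNIV, S)"]) (force simp: ge_def good_def E_def dest!: p)+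
    qed
    show "((\<lambda>n. \<phi> ((tn \<circ> p) n) ((xn' \<circ> p) n)) \<longlongrightarrow> z) (tails E ge)"
    proof (rule conv)
      fix S assume "open S" "z \<in> S"
      then show "\<exists>i\<in>E. \<forall>j\<in>E. ge i j \<longrightarrow> \<phi> ((tn \<circ> p) j) ((xn' \<circ> p) j) \<in> S"
        by (intro bexI[of _ "(UNIV, UNIV, S)"]) (force simp: ge_def good_def E_def dest!: p)+
    qed
  qed
  then show ?thesis unfolding Q_rel_def mem_Collect_eq case_prod_conv by (intro exI)
qed

end

theory Submission
  imports Defs
begin

text \<open>
  Since \<open>X\<close> is compact, \<open>Q\<close> is a projection along \<open>X\<close> of a closed set, hence closed. So it suffices
  to treat \<open>t\<close> with \<open>K\<close>, the closure of \<open>T - Tt\<close>, compact. Each \<open>t\<^sub>n\<close> lies in \<open>Tt\<close> or in \<open>K\<close>.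
  If \<open>t\<^sub>n = s\<^sub>n t\<close> frequently, then \<open>s\<^sub>n\<close>, \<open>t x\<^sub>n\<close>, \<open>t y\<^sub>n\<close> witness \<open>(tx, ty) \<in> Q\<close>. If \<open>t\<^sub>n \<in> K\<close>
  frequently, a limit point \<open>k\<close> of \<open>t\<^sub>n\<close> satisfies \<open>kx = ky\<close>, so \<open>x = y\<close> by injectivity.
\<close>

text \<open>Only points of \<open>X\<close> are recorded, so the net in \<open>T\<close>, which need
  not converge, drops out and \<open>Q\<close> becomes a closure condition in the fourth power of
  \<open>X\<close>. The parameter \<open>A\<close> allows \<open>T\<close> to be split into
  pieces.\<close>

definition orbit_quads :: "('t \<Rightarrow> 'x \<Rightarrow> 'x) \<Rightarrow> 't set \<Rightarrow> ('x \<times> 'x \<times> 'x \<times> 'x) set" where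
  "orbit_quads \<phi> A = (\<lambda>(s, a, b). (a, b, \<phi> s a, \<phi> s b)) ` (A \<times> UNIV)"

lemma orbit_quadsI: "s \<in> A \<Longrightarrow> (a, b, \<phi> s a, \<phi> s b) \<in> orbit_quads \<phi> A"
  by (auto simp: orbit_quads_def intro!: image_eqI[of _ _ "(s, a, b)"])

lemma tails_neq_bot:
  assumes "directed_set D le"
  shows "tails D le \<noteq> bot"
proof -
  have "\<not> eventually (\<lambda>_. False) (tails D le)"
    using assms unfolding eventually_tails[OF assms] directed_set_def by blast
  then show ?thesis by (simp add: trivial_limit_def)
qed

text \<open>The net is indexed by the open neighbourhoods of \<open>p\<close> under reverse
  inclusion, with a point of \<open>S\<close> chosen in each.\<close>

lemma closure_imp_net:
  fixes p :: "'a::topological_space"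
  assumes "p \<in> closure S"
  obtains D :: "'a set set" and le f
  where "directed_set D le" "\<And>i. i \<in> D \<Longrightarrow> f i \<in> S" "(f \<longlongrightarrow> p) (tails D le)"
proof -
  define D where "D = {U. open U \<and> p \<in> U}"
  define le where "le = (\<lambda>U V :: 'a set. V \<subseteq> U)"
  have "\<exists>q. q \<in> U \<inter> S" if "U \<in> D" for U
    using assms that open_Int_closure_eq_empty[of U S] by (auto simp: D_def)
  then obtain f where f: "\<And>U. U \<in> D \<Longrightarrow> f U \<in> U \<inter> S" by metis
  have dir: "directed_set D le"
    unfolding directed_set_def
  proof (intro conjI ballI)
    show "D \<noteq> {}" by (auto simp: D_def)
    fix U V assume "U \<in> D" "V \<in> D"
    then show "\<exists>W\<in>D. le U W \<and> le V W"
      by (intro bexI[of _ "U \<inter> V"]) (auto simp: D_def le_def)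
  qed (auto simp: le_def)
  moreover have "(f \<longlongrightarrow> p) (tails D le)"
  proof (rule topological_tendstoI)
    fix U assume "open U" "p \<in> U"
    then have "U \<in> D" by (simp add: D_def)
    moreover have "\<forall>V\<in>D. le U V \<longrightarrow> f V \<in> U" using f by (auto simp: le_def)
    ultimately show "eventually (\<lambda>i. f i \<in> U) (tails D le)"
      unfolding eventually_tails[OF dir] by blast
  qed
  ultimately show thesis using f by (intro that[of D le f]) auto
qed

text \<open>Nets witnessing regional proximality are exactly nets of orbit quadruples whose limit
  has equal last two coordinates.\<close>

lemma Q_rel_iff_closure:
  "(x, y) \<in> Q_rel \<phi> \<longleftrightarrow> (\<exists>z. (x, y, z, z) \<in> closure (orbit_quads \<phi> UNIV))"
proof
  assume "(x, y) \<in> Q_rel \<phi>"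
  then obtain D :: "('a set \<times> 'a set \<times> 'a set) set" and le xn yn tn
    where "regionally_proximal_nets \<phi> x y D le xn yn tn"
    by (auto simp: Q_rel_def)
  then obtain z where dir: "directed_set D le"
    and lim: "(xn \<longlongrightarrow> x) (tails D le)" "(yn \<longlongrightarrow> y) (tails D le)"
      "((\<lambda>n. \<phi> (tn n) (xn n)) \<longlongrightarrow> z) (tails D le)" "((\<lambda>n. \<phi> (tn n) (yn n)) \<longlongrightarrow> z) (tails D le)"
    by (auto simp: regionally_proximal_nets_def)
  have conv: "((\<lambda>n. (xn n, yn n, \<phi> (tn n) (xn n), \<phi> (tn n) (yn n))) \<longlongrightarrow> (x, y, z, z)) (tails D le)"
    by (intro tendsto_Pair lim)
  have "(x, y, z, z) \<in> closure (orbit_quads \<phi> UNIV)"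
  proof (rule Lim_in_closed_set[OF closed_closure _ tails_neq_bot[OF dir] conv])
    show "\<forall>\<^sub>F n in tails D le.
        (xn n, yn n, \<phi> (tn n) (xn n), \<phi> (tn n) (yn n)) \<in> closure (orbit_quads \<phi> UNIV)"
      by (intro always_eventually allI subsetD[OF closure_subset] orbit_quadsI UNIV_I)
  qed
  then show "\<exists>z. (x, y, z, z) \<in> closure (orbit_quads \<phi> UNIV)" ..
next
  assume "\<exists>z. (x, y, z, z) \<in> closure (orbit_quads \<phi> UNIV)"
  then obtain z where "(x, y, z, z) \<in> closure (orbit_quads \<phi> UNIV)" ..
  then obtain D :: "('a \<times> 'a \<times> 'a \<times> 'a) set set" and le f
    where dir: "directed_set D le" and f: "\<And>i. i \<in> D \<Longrightarrow> f i \<in> orbit_quads \<phi> UNIV"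
      and lim: "(f \<longlongrightarrow> (x, y, z, z)) (tails D le)"
    by (rule closure_imp_net) blast
  have "\<exists>s a b. f i = (a, b, \<phi> s a, \<phi> s b)" if "i \<in> D" for i
    using f[OF that] by (auto simp: orbit_quads_def)
  then obtain s a b where s: "\<And>i. i \<in> D \<Longrightarrow> f i = (a i, b i, \<phi> (s i) (a i), \<phi> (s i) (b i))"
    by metis
  have "D \<noteq> {}" using dir by (simp add: directed_set_def)
  then have "eventually (\<lambda>i. f i = (a i, b i, \<phi> (s i) (a i), \<phi> (s i) (b i))) (tails D le)"
    using s unfolding eventually_tails[OF dir] by blast
  with lim have "((\<lambda>i. (a i, b i, \<phi> (s i) (a i), \<phi> (s i) (b i))) \<longlongrightarrow> (x, y, z, z)) (tails D le)"
    by (rule Lim_transform_eventually)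
  note lim1 = tendsto_fst[OF this] and lim2 = tendsto_snd[OF this]
  have "regionally_proximal_nets \<phi> x y D le a b s"
    unfolding regionally_proximal_nets_def
    using dir lim1 tendsto_fst[OF lim2] tendsto_fst[OF tendsto_snd[OF lim2]]
      tendsto_snd[OF tendsto_snd[OF lim2]] by auto
  \<comment> \<open>The nets here are indexed by sets of quadruples, not by the index type fixed in
    \<open>Q_rel\<close>, hence the change of index.\<close>
  then show "(x, y) \<in> Q_rel \<phi>" by (rule Q_rel_if_nets)
qed

lemma closed_Q_rel:
  fixes \<phi> :: "'t::topological_monoid_mult \<Rightarrow> 'x::t2_space \<Rightarrow> 'x"
  assumes "compact (UNIV :: 'x set)"
  shows "closed (Q_rel \<phi>)"
proof -
  \<comment> \<open>The common limit \<open>z\<close> is kept as an extra coordinate, so that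
    forgetting it is the projection \<open>fst\<close>.\<close>
  define C where "C = (\<lambda>((x, y), z). (x, y, z, z)) -` closure (orbit_quads \<phi> UNIV)"
  have "closed C"
    unfolding C_def
    by (intro closed_vimage closed_closure) (auto simp: case_prod_unfold intro!: continuous_intros)
  moreover have "compact (UNIV :: (('x \<times> 'x) \<times> 'x) set)"
    using compact_Times[OF compact_Times[OF assms assms] assms] by simp
  ultimately have "compact (fst ` C)"
    by (intro compact_continuous_image continuous_on_fst continuous_on_id)
      (use compact_Int_closed in fastforce)
  moreover have "Q_rel \<phi> = fst ` C"
  proof (intro set_eqI iffI)
    fix p assume "p \<in> Q_rel \<phi>"
    then obtain z where "(p, z) \<in> C" by (cases p) (auto simp: C_def Q_rel_iff_closure)
    then show "p \<in> fst ` C" by (rule image_eqI[rotated]) simp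
  qed (auto simp: C_def Q_rel_iff_closure)
  ultimately show ?thesis by (simp add: compact_imp_closed)
qed

lemma semiflow_continuous_intro:
  assumes "semiflow \<phi>" "continuous_on S f" "continuous_on S g"
  shows "continuous_on S (\<lambda>u. \<phi> (f u) (g u))"
proof -
  have "continuous_on UNIV (\<lambda>(t, x). \<phi> t x)" using assms(1) by (simp add: semiflow_def)
  from continuous_on_compose2[OF this continuous_on_Pair[OF assms(2,3)]]
  show ?thesis by simp
qed

text \<open>This is a continuous image of a compact product inside a Hausdorff space. Hence a limit
  of quadruples over \<open>K\<close> is itself the quadruple of some \<open>k\<close> in
  \<open>K\<close>.\<close>

lemma closed_orbit_quads:
  fixes \<phi> :: "'t::topological_monoid_mult \<Rightarrow> 'x::t2_space \<Rightarrow> 'x"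
  assumes "compact (UNIV :: 'x set)" "semiflow \<phi>" "compact K"
  shows "closed (orbit_quads \<phi> K)"
proof -
  have "compact (UNIV :: ('x \<times> 'x) set)"
    using compact_Times[OF assms(1) assms(1)] by simp
  then have "compact (orbit_quads \<phi> K)"
    unfolding orbit_quads_def case_prod_unfold
    by (intro compact_continuous_image compact_Times assms(3) continuous_on_Pair
        semiflow_continuous_intro[OF assms(2)] continuous_intros)
  then show ?thesis by (rule compact_imp_closed)
qed

lemma Q_rel_translate:
  fixes \<phi> :: "'t::topological_monoid_mult \<Rightarrow> 'x::t2_space \<Rightarrow> 'x"
  assumes X: "compact (UNIV :: 'x set)" and inv: "invertible_semiflow \<phi>"
    and t: "compact (closure (UNIV - range (\<lambda>s. s * t)))"
    and xy: "(x, y) \<in> Q_rel \<phi>"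
  shows "(\<phi> t x, \<phi> t y) \<in> Q_rel \<phi>"
proof -
  have flow: "semiflow \<phi>" and inj: "\<And>s. inj (\<phi> s)"
    using inv by (auto simp: invertible_semiflow_def bij_def)
  define R where "R = range (\<lambda>s. s * t)"
  define K where "K = closure (UNIV - R)"
  from xy obtain z where z: "(x, y, z, z) \<in> closure (orbit_quads \<phi> UNIV)"
    by (auto simp: Q_rel_iff_closure)
  have "R \<union> K = UNIV" using closure_subset[of "UNIV - R"] by (auto simp: K_def)
  moreover have "orbit_quads \<phi> (R \<union> K) = orbit_quads \<phi> R \<union> orbit_quads \<phi> K"
    by (simp only: orbit_quads_def Sigma_Un_distrib1 image_Un)
  ultimately have "orbit_quads \<phi> UNIV = orbit_quads \<phi> R \<union> orbit_quads \<phi> K"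
    by simp
  moreover have "closed (orbit_quads \<phi> K)"
    using closed_orbit_quads[OF X flow] t by (simp add: K_def R_def)
  \<comment> \<open>Closure commutes with finite unions, and the part over \<open>K\<close> is
    already closed; this replaces passing to subnets.\<close>
  ultimately consider "(x, y, z, z) \<in> closure (orbit_quads \<phi> R)" | "(x, y, z, z) \<in> orbit_quads \<phi> K"
    using z by auto
  then show ?thesis
  proof cases
    case 1
    \<comment> \<open>Since \<open>(s * t) a = s (t a)\<close> under the action, moving only the
      first two coordinates by \<open>t\<close> turns a quadruple of \<open>s * t\<close> into one
      of \<open>s\<close>.\<close>
    define g where "g = (\<lambda>(a, b, c, d). (\<phi> t a, \<phi> t b, c :: 'x, d :: 'x))"
    have "continuous_on UNIV g"
      unfolding g_def case_prod_unfold
      by (intro continuous_on_Pair semiflow_continuous_intro[OF flow] continuous_intros)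
    moreover have "g ` orbit_quads \<phi> R \<subseteq> closure (orbit_quads \<phi> UNIV)"
    proof -
      have "\<phi> (s * t) a = \<phi> s (\<phi> t a)" for s a using flow by (simp add: semiflow_def)
      then have "g ` orbit_quads \<phi> R \<subseteq> orbit_quads \<phi> UNIV"
        unfolding g_def orbit_quads_def R_def by (clarsimp simp: image_iff) blast
      then show ?thesis using closure_subset by blast
    qed
    ultimately have "g ` closure (orbit_quads \<phi> R) \<subseteq> closure (orbit_quads \<phi> UNIV)"
      using image_closure_subset[OF continuous_on_subset[OF _ subset_UNIV] closed_closure] by blast
    with 1 have "g (x, y, z, z) \<in> closure (orbit_quads \<phi> UNIV)" by blast
    then show ?thesis by (auto simp: g_def Q_rel_iff_closure)
  next
    case 2
    \<comment> \<open>Some \<open>k\<close> in \<open>K\<close> sends both \<open>x\<close> and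
      \<open>y\<close> to \<open>z\<close>.\<close>
    then have "x = y" using inj by (auto simp: orbit_quads_def dest: injD)
    \<comment> \<open>The diagonal lies in \<open>Q\<close>, with the identity of \<open>T\<close>
      as witness.\<close>
    moreover have "(\<phi> t x, \<phi> t x, \<phi> 1 (\<phi> t x), \<phi> 1 (\<phi> t x)) \<in> closure (orbit_quads \<phi> UNIV)"
      by (intro subsetD[OF closure_subset] orbit_quadsI UNIV_I)
    ultimately show ?thesis by (auto simp: Q_rel_iff_closure)
  qed
qed

theorem theorem0p12:
  fixes \<phi> :: "'t::topological_monoid_mult \<Rightarrow> 'x::t2_space \<Rightarrow> 'x"
  assumes "compact (UNIV :: 'x set)"
    and "invertible_semiflow \<phi>"
    and "almost_right_C_semigroup TYPE('t)"
  shows "\<forall>x y t. (x, y) \<in> Q_rel \<phi> \<longrightarrow> (\<phi> t x, \<phi> t y) \<in> Q_rel \<phi>"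
proof (intro allI impI)
  fix x y t assume xy: "(x, y) \<in> Q_rel \<phi>"
  have flow: "semiflow \<phi>" using assms(2) by (simp add: invertible_semiflow_def)
  \<comment> \<open>For fixed \<open>x\<close> and \<open>y\<close>, the good \<open>t\<close> form
    a closed set by continuity of the action in \<open>t\<close>; it remains to see that it contains
    a dense set.\<close>
  define B where "B = (\<lambda>t. (\<phi> t x, \<phi> t y)) -` Q_rel \<phi>"
  have "closed B"
    unfolding B_def
    by (intro closed_vimage closed_Q_rel assms(1) continuous_on_Pair
        semiflow_continuous_intro[OF flow] continuous_intros)
  moreover have "{t. compact (closure (UNIV - range (\<lambda>s. s * t)))} \<subseteq> B"
    using Q_rel_translate[OF assms(1,2) _ xy] by (auto simp: B_def)
  ultimately have "closure {t::'t. compact (closure (UNIV - range (\<lambda>s. s * t)))} \<subseteq> B"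
    by (intro closure_minimal)
  then have "t \<in> B" using assms(3) by (auto simp: almost_right_C_semigroup_def)
  then show "(\<phi> t x, \<phi> t y) \<in> Q_rel \<phi>" by (simp add: B_def)
qed

end
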